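(* Let $\mathcal{A}(\lambda)=A_0+\sum_{i=1}^m\lambda_iA_i$ with $A_i\in\mathbb{C}^{k\times\ell}$, $k=\ell+m-1$, define a rectangular multiparameter eigenvalue problem, let $E_0,\dots,E_m\in\mathbb{C}^{k\times\ell}$ be given error matrices, and let $\tilde\lambda\in\mathbb{C}^m$. Then the norm-wise backward eigenvalue error at $\tilde\lambda$ is $$\eta(\tilde\lambda)=\frac{\sigma_{\min}(\mathcal{A}(\tilde\lambda))}{\tilde\gamma},\qquad \tilde\gamma=\|E_0\|_2+\sum_{i=1}^m|\tilde\lambda_i|\,\|E_i\|_2,$$ where $\sigma_{\min}(\cdot)$ denotes the smallest singular value.
   Context: $\|\cdot\|_2$ denotes the Euclidean norm of vectors and the induced (spectral) norm of matrices. Rectangular multiparameter eigenvalue problem: the matrices $A_0,\dots,A_m\in\mathbb{C}^{k\times\ell}$, $k=\ell+m-1$, are such that $\mathcal{A}(\lambda)=A_0+\sum_{i=1}^m\lambda_iA_i$ has full normal rank (rank $\ell$ at a generic $\lambda\in\mathbb{C}^m$); one seeks $\lambda\in\mathbb{C}^m$ and $x\in\mathbb{C}^\ell\setminus\{0\}$ with $\mathcal{A}(\lambda)x=0$. Since $k\ge\ell$, $\sigma_{\min}$ of a $k\times\ell$ matrix is its $\ell$-th (smallest) singular value. For $x\in\mathbb{C}^\ell$ with $\|x\|_2=1$, the norm-wise backward error of $(\tilde\lambda,x)$ is $$\eta(\tilde\lambda,x)=\min\Big\{\epsilon\ge 0:\ \exists\,\Delta A_0,\dots,\Delta A_m\in\mathbb{C}^{k\times\ell},\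 \Big(A_0+\Delta A_0+\sum_{i=1}^m\tilde\lambda_i(A_i+\Delta A_i)\Big)x=0,\ \|\Delta A_i\|_2\le\epsilon\|E_i\|_2,\ i=0,\dots,m\Big\},$$ with value $+\infty$ if no such $\epsilon$ exists. The norm-wise backward eigenvalue error is $\eta(\tilde\lambda)=\min_{\|x\|_2=1}\eta(\tilde\lambda,x)$. Convention: if $\sigma_{\min}(\mathcal{A}(\tilde\lambda))=0$ the quotient is read as $0$ even if $\tilde\gamma=0$; if $\sigma_{\min}(\mathcal{A}(\tilde\lambda))\ne0$ and $\tilde\gamma=0$ it is read as $+\infty$. *)

theory Defs
  imports "HOL-Analysis.Analysis"
begin

text \<open>
  The coefficients \<open>A\<^sub>0\<close> and \<open>A\<^sub>1, \<dots>, A\<^sub>m\<close> are passed separately, the latter as a family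
  indexed by the type \<open>'m\<close> with \<open>CARD('m) = m\<close>.
\<close>

definition pencil ::
    "complex^'l^'k \<Rightarrow> ('m::finite \<Rightarrow> complex^'l^'k) \<Rightarrow> complex^'m \<Rightarrow> complex^'l^'k" where
  "pencil A0 A lam = (\<chi> i j. A0 $ i $ j + (\<Sum>s\<in>UNIV. lam $ s * A s $ i $ j))"

definition complex_polynomial_function :: "(complex^'m::finite \<Rightarrow> complex) \<Rightarrow> bool" where
  "complex_polynomial_function q \<longleftrightarrow>
     (\<exists>(S :: ('m \<Rightarrow> nat) set) c. finite S \<and>
        q = (\<lambda>z. \<Sum>a\<in>S. c a * (\<Prod>s\<in>UNIV. z $ s ^ a s)))"

text \<open>Generic means: off the zero set of some polynomial that is not identically zero.\<close>

definition holds_generically :: "(complex^'m::finite \<Rightarrow> bool) \<Rightarrow> bool" where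
  "holds_generically P \<longleftrightarrow>
     (\<exists>q. complex_polynomial_function q \<and> (\<exists>z. q z \<noteq> 0) \<and> (\<forall>z. q z \<noteq> 0 \<longrightarrow> P z))"

definition full_normal_rank ::
    "complex^'l^'k \<Rightarrow> ('m::finite \<Rightarrow> complex^'l^'k) \<Rightarrow> bool" where
  "full_normal_rank A0 A \<longleftrightarrow> holds_generically (\<lambda>lam. rank (pencil A0 A lam) = CARD('l))"

definition spectral_norm :: "complex^'l^'k \<Rightarrow> real" where
  "spectral_norm A = onorm (\<lambda>x. A *v x)"

definition conjugate_transpose :: "complex^'l^'k \<Rightarrow> complex^'k^'l" where
  "conjugate_transpose A = (\<chi> i j. cnj (A $ j $ i))"

text \<open>
  The nonnegative square roots of the eigenvalues of \<open>A\<^sup>H A\<close>. This \<open>l \<times> l\<close> matrix accounts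
  for all \<open>min k l\<close> singular values of a \<open>k \<times> l\<close> matrix, and for no others, when \<open>k \<ge> l\<close>.
\<close>

definition singular_values :: "complex^'l^'k \<Rightarrow> real set" where
  "singular_values A =
     {s. 0 \<le> s \<and> (\<exists>x. x \<noteq> 0 \<and>
        (conjugate_transpose A ** A) *v x = complex_of_real (s^2) *s x)}"

definition sigma_min :: "complex^'l^'k \<Rightarrow> real" where
  "sigma_min A = Min (singular_values A)"

definition admissible_backward_error ::
    "complex^'l^'k \<Rightarrow> ('m::finite \<Rightarrow> complex^'l^'k) \<Rightarrow>
     complex^'l^'k \<Rightarrow> ('m \<Rightarrow> complex^'l^'k) \<Rightarrow> complex^'m \<Rightarrow> complex^'l \<Rightarrow> real \<Rightarrow> bool" where
  "admissible_backward_error A0 A E0 E lam x e \<longleftrightarrow>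
     0 \<le> e \<and>
     (\<exists>D0 D. pencil (A0 + D0) (\<lambda>s. A s + D s) lam *v x = 0 \<and>
        spectral_norm D0 \<le> e * spectral_norm E0 \<and>
        (\<forall>s. spectral_norm (D s) \<le> e * spectral_norm (E s)))"

definition backward_error ::
    "complex^'l^'k \<Rightarrow> ('m::finite \<Rightarrow> complex^'l^'k) \<Rightarrow>
     complex^'l^'k \<Rightarrow> ('m \<Rightarrow> complex^'l^'k) \<Rightarrow> complex^'m \<Rightarrow> complex^'l \<Rightarrow> ereal" where
  "backward_error A0 A E0 E lam x =
     (if \<exists>e. admissible_backward_error A0 A E0 E lam x e
      then ereal (LEAST e. admissible_backward_error A0 A E0 E lam x e)
      else \<infinity>)"

definition backward_eigenvalue_error ::
    "complex^'l^'k \<Rightarrow> ('m::finite \<Rightarrow> complex^'l^'k) \<Rightarrow>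
     complex^'l^'k \<Rightarrow> ('m \<Rightarrow> complex^'l^'k) \<Rightarrow> complex^'m \<Rightarrow> ereal" where
  "backward_eigenvalue_error A0 A E0 E lam =
     (LEAST r. \<exists>x. norm x = 1 \<and> r = backward_error A0 A E0 E lam x)"

definition error_weight ::
    "complex^'l^'k \<Rightarrow> ('m::finite \<Rightarrow> complex^'l^'k) \<Rightarrow> complex^'m \<Rightarrow> real" where
  "error_weight E0 E lam =
     spectral_norm E0 + (\<Sum>s\<in>UNIV. cmod (lam $ s) * spectral_norm (E s))"

text \<open>
  Division on \<^typ>\<open>ereal\<close> follows the convention for a vanishing denominator:
  \<open>0 / 0 = 0\<close>, and \<open>s / 0 = \<infinity>\<close> for \<open>s > 0\<close>.
\<close>

lemma ereal_quotient_convention: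
  assumes "0 \<le> s"
  shows "ereal s / ereal g =
     (if s = 0 then 0 else if g = 0 then \<infinity> else ereal (s / g))"
  using assms by (auto simp: divide_ereal_def divide_real_def zero_ereal_def[symmetric])

end

theory Submission
  imports Defs
begin

text \<open>
  Write \<open>B\<close> for the pencil evaluated at \<open>lam\<close> and \<open>\<gamma>\<close> for the error weight. For a unit
  vector \<open>x\<close> everything is decided by the residual \<open>r = B x\<close>. Perturbations of relative size
  \<open>e\<close> change \<open>B x\<close> by a vector of norm at most \<open>e \<gamma>\<close>, so cancelling \<open>r\<close> requires
  \<open>\<parallel>r\<parallel> \<le> e \<gamma>\<close>. Conversely, under this bound rank-one perturbations, all of them multiples of
  \<open>r x\<^sup>H\<close>, cancel \<open>r\<close>: coefficient \<open>s\<close> receives the share \<open>\<parallel>E\<^sub>s\<parallel> / \<gamma>\<close>, rotated by the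
  conjugate phase of \<open>lam\<^sub>s\<close>, so that all contributions to \<open>B x\<close> point in the direction
  \<open>- r\<close> and add up to exactly \<open>- r\<close>. Thus admissibility of \<open>e\<close> amounts to
  \<open>0 \<le> e \<and> \<parallel>B x\<parallel> \<le> e \<gamma>\<close> (lemma \<open>admissible_backward_error_iff\<close>), and the backward error
  of \<open>x\<close> is \<open>\<parallel>B x\<parallel> / \<gamma>\<close>.

  It remains to minimise \<open>\<parallel>B x\<parallel>\<close> over the unit sphere. The minimum exists by compactness,
  and it is the smallest singular value (lemma \<open>sigma_min_attained\<close>). Indeed, a minimiser is
  a critical point of the Rayleigh quotient, hence an eigenvector of \<open>B\<^sup>H B\<close>, while every other
  singular value is the norm of \<open>B\<close> on some unit vector. Since the smallest singular value
  is defined as the minimum of a set of eigenvalue roots, finiteness of that set is needed too;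
  it follows from orthogonality of eigenvectors.

  The space of complex vectors carries the real inner product \<open>Re (y\<^sup>H x)\<close>. This real structure
  suffices throughout, because a vector is determined by its real inner products, and
  \<open>B\<^sup>H B\<close> is symmetric with respect to them.
\<close>

section \<open>Norms of complex vectors and matrices\<close>

lemma scaleR_smult: "complex_of_real s *s x = s *\<^sub>R (x :: complex^'n)"
  by (simp add: vec_eq_iff scaleR_conv_of_real[where 'a = complex])

lemma norm_smult: "norm (c *s (x :: complex^'n)) = cmod c * norm x"
  by (simp add: norm_vec_def norm_mult L2_set_right_distrib)

lemma bounded_linear_mult_vec: "bounded_linear (\<lambda>x. (B :: complex^'l^'k) *v x)"
  by (rule matrix_vector_mul_bounded_linear)

lemma norm_mult_vec_le: "norm ((B :: complex^'l^'k) *v x) \<le> spectral_norm B * norm x"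
  unfolding spectral_norm_def by (rule onorm) (rule bounded_linear_mult_vec)

lemma spectral_norm_nonneg: "0 \<le> spectral_norm (B :: complex^'l^'k)"
  unfolding spectral_norm_def by (rule onorm_pos_le) (rule bounded_linear_mult_vec)

lemma error_weight_nonneg: "0 \<le> error_weight E0 E lam"
  unfolding error_weight_def by (intro add_nonneg_nonneg sum_nonneg mult_nonneg_nonneg spectral_norm_nonneg) simp

section \<open>The smallest singular value as a minimum over the unit sphere\<close>

lemma inner_conjugate_transpose:
  fixes B :: "complex^'l^'k"
  shows "(B *v x) \<bullet> y = x \<bullet> (conjugate_transpose B *v y)"
proof -
  have mv: "(c * a) \<bullet> b = a \<bullet> (cnj c * b)" for a b c :: complex
    by (simp add: inner_complex_def algebra_simps)
  have "(B *v x) \<bullet> y = (\<Sum>i\<in>UNIV. \<Sum>j\<in>UNIV. (B $ i $ j * x $ j) \<bullet> (y $ i))"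
    by (simp add: inner_vec_def matrix_vector_mult_def inner_sum_left)
  also have "\<dots> = (\<Sum>j\<in>UNIV. \<Sum>i\<in>UNIV. (B $ i $ j * x $ j) \<bullet> (y $ i))"
    by (rule sum.swap)
  also have "\<dots> = x \<bullet> (conjugate_transpose B *v y)"
    by (simp add: inner_vec_def matrix_vector_mult_def inner_sum_right conjugate_transpose_def mv)
  finally show ?thesis .
qed

text \<open>
  The eigenvector equation for \<open>B\<^sup>H B\<close>, tested against all vectors. In this weak form it is
  directly comparable with a first-order optimality condition.
\<close>

lemma singular_value_iff:
  fixes B :: "complex^'l^'k"
  shows "s \<in> singular_values B \<longleftrightarrow>
    0 \<le> s \<and> (\<exists>x. x \<noteq> 0 \<and> (\<forall>y. (B *v x) \<bullet> (B *v y) = s\<^sup>2 * (x \<bullet> y)))"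
proof -
  have "(conjugate_transpose B ** B) *v x = complex_of_real (s\<^sup>2) *s x
      \<longleftrightarrow> (\<forall>y. (B *v x) \<bullet> (B *v y) = s\<^sup>2 * (x \<bullet> y))" for x
  proof -
    have "(conjugate_transpose B ** B) *v x = complex_of_real (s\<^sup>2) *s x
       \<longleftrightarrow> (\<forall>y. y \<bullet> (conjugate_transpose B *v (B *v x)) = y \<bullet> (s\<^sup>2 *\<^sub>R x))"
      by (simp only: scaleR_smult matrix_vector_mul_assoc[symmetric] vector_eq_ldot)
    also have "\<dots> \<longleftrightarrow> (\<forall>y. (B *v x) \<bullet> (B *v y) = s\<^sup>2 * (x \<bullet> y))"
      by (simp add: inner_conjugate_transpose[symmetric] inner_commute)
    finally show ?thesis .
  qed
  then show ?thesis unfolding singular_values_def by simp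
qed

text \<open>
  Eigenvectors of \<open>B\<^sup>H B\<close> for distinct eigenvalues are orthogonal, and a finite-dimensional
  space has no infinite orthogonal family of nonzero vectors.
\<close>

lemma finite_singular_values: "finite (singular_values (B :: complex^'l^'k))"
proof -
  let ?S = "singular_values B"
  obtain v where v: "\<And>s. s \<in> ?S \<Longrightarrow> 0 \<le> s \<and> v s \<noteq> 0 \<and> (\<forall>y. (B *v v s) \<bullet> (B *v y) = s\<^sup>2 * (v s \<bullet> y))"
    using singular_value_iff[of _ B] by metis
  have orth: "v s \<bullet> v t = 0" if "s \<in> ?S" "t \<in> ?S" "s \<noteq> t" for s t
  proof -
    have "s\<^sup>2 * (v s \<bullet> v t) = t\<^sup>2 * (v s \<bullet> v t)"
      using v[OF that(1)] v[OF that(2)] by (metis inner_commute)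
    moreover have "s\<^sup>2 \<noteq> t\<^sup>2"
      using v[OF that(1)] v[OF that(2)] that(3) by simp
    ultimately show ?thesis by simp
  qed
  have "inj_on v ?S"
    using orth v by (metis (no_types, lifting) inj_onI inner_eq_zero_iff)
  moreover have "finite (v ` ?S)"
    by (rule pairwise_orthogonal_imp_finite)
      (auto simp: pairwise_def orthogonal_def intro!: orth)
  ultimately show ?thesis by (rule finite_imageD[rotated])
qed

text \<open>
  First variation: the quadratic form \<open>\<parallel>B y\<parallel>\<^sup>2 - \<parallel>B x\<parallel>\<^sup>2 \<parallel>y\<parallel>\<^sup>2\<close> is nonnegative and vanishes
  at \<open>y = x\<close>, so its derivative at \<open>x\<close> vanishes in every direction \<open>z\<close>. That is the weak
  eigenvector equation.
\<close>

lemma minimum_gives_singular_value: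
  fixes B :: "complex^'l^'k"
  assumes "norm x = 1" and min: "\<And>y. norm (B *v x) * norm y \<le> norm (B *v y)"
  shows "norm (B *v x) \<in> singular_values B"
proof -
  let ?m = "norm (B *v x)"
  have "(B *v x) \<bullet> (B *v z) = ?m\<^sup>2 * (x \<bullet> z)" for z
  proof -
    \<comment> \<open>The form at \<open>x + t z\<close> is the polynomial \<open>2 t b + t\<^sup>2 c\<close>.\<close>
    define b where "b = (B *v x) \<bullet> (B *v z) - ?m\<^sup>2 * (x \<bullet> z)"
    define c where "c = (norm (B *v z))\<^sup>2 - ?m\<^sup>2 * (norm z)\<^sup>2"
    have xx: "x \<bullet> x = 1" using assms(1) by (simp add: norm_eq_1)
    have q: "0 \<le> 2 * t * b + t\<^sup>2 * c" for t
    proof -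
      have "(?m * norm (x + t *\<^sub>R z))\<^sup>2 \<le> (norm (B *v (x + t *\<^sub>R z)))\<^sup>2"
        by (intro power_mono min) simp
      then show ?thesis
        unfolding b_def c_def power_mult_distrib power2_norm_eq_inner
        by (simp add: matrix_vector_right_distrib linear_scale[OF bounded_linear.linear[OF bounded_linear_mult_vec]]
            inner_add_left inner_add_right xx inner_commute algebra_simps power2_eq_square)
    qed
    have "b = 0"
    proof (rule ccontr)
      assume "b \<noteq> 0"
      have c0: "0 \<le> c" using power_mono[OF min[of z], of 2] by (simp add: c_def power_mult_distrib)
      define d where "d = c + 1"
      have d: "0 < d" "c = d - 1" using c0 by (auto simp: d_def)
      \<comment> \<open>The exact minimiser is \<open>- b / c\<close>; the shift by one keeps the step finite for \<open>c = 0\<close>.\<close>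
      define t where "t = - b / d"
      have "2 * t * b + t\<^sup>2 * c = - (b\<^sup>2 * (d + 1)) / d\<^sup>2"
        using d(1) unfolding t_def d(2) by (simp add: field_simps power2_eq_square)
      also have "\<dots> < 0" using d(1) \<open>b \<noteq> 0\<close> by (simp add: divide_neg_pos mult_pos_pos)
      finally show False using q[of t] by simp
    qed
    then show ?thesis by (simp add: b_def)
  qed
  then show ?thesis
    using assms(1) unfolding singular_value_iff by (auto intro!: exI[of _ x])
qed

lemma sigma_min_attained:
  fixes B :: "complex^'l^'k"
  obtains x where "norm x = 1" "norm (B *v x) = sigma_min B"
    and "\<And>y. norm y = 1 \<Longrightarrow> sigma_min B \<le> norm (B *v y)"
proof -
  have "\<exists>x\<in>sphere (0::complex^'l) 1. \<forall>y\<in>sphere 0 1. norm (B *v x) \<le> norm (B *v y)"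
  proof (rule continuous_attains_inf)
    show "sphere (0::complex^'l) 1 \<noteq> {}" by simp
    show "continuous_on (sphere 0 1) (\<lambda>x. norm (B *v x))"
      by (intro continuous_on_norm linear_continuous_on bounded_linear_mult_vec)
  qed simp
  then obtain x where x: "norm x = 1" "\<And>y. norm y = 1 \<Longrightarrow> norm (B *v x) \<le> norm (B *v y)"
    by auto
  have min: "norm (B *v x) * norm y \<le> norm (B *v y)" for y
  proof (cases "y = 0")
    case False
    then have "norm (B *v x) \<le> norm (B *v ((1 / norm y) *\<^sub>R y))" by (intro x) simp
    also have "\<dots> = norm (B *v y) / norm y"
      by (simp add: linear_scale[OF bounded_linear.linear[OF bounded_linear_mult_vec]])
    finally show ?thesis using False by (simp add: field_simps)
  qed simp
  have "sigma_min B = norm (B *v x)"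
    unfolding sigma_min_def
  proof (rule Min_eqI)
    show "finite (singular_values B)" by (rule finite_singular_values)
    show "norm (B *v x) \<in> singular_values B"
      by (rule minimum_gives_singular_value[OF x(1) min])
    fix s assume "s \<in> singular_values B"
    then obtain z where s: "0 \<le> s" "z \<noteq> 0" "(B *v z) \<bullet> (B *v z) = s\<^sup>2 * (z \<bullet> z)"
      unfolding singular_value_iff by auto
    then have "(norm (B *v z))\<^sup>2 = (s * norm z)\<^sup>2"
      by (simp add: power2_norm_eq_inner power_mult_distrib)
    then have "norm (B *v z) = s * norm z" using s(1) by simp
    then show "norm (B *v x) \<le> s" using min[of z] s(2) by simp
  qed
  then show ?thesis using x that by metis
qed

section \<open>Cancelling a residual by perturbing the coefficients\<close>

lemma pencil_mult_vec:
  "pencil A0 A lam *v x = A0 *v x + (\<Sum>s\<in>UNIV. lam $ s *s (A s *v x))"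
  unfolding vec_eq_iff
proof
  fix i
  have "(\<Sum>j\<in>UNIV. (\<Sum>s\<in>UNIV. lam $ s * A s $ i $ j) * x $ j)
     = (\<Sum>s\<in>UNIV. lam $ s * (\<Sum>j\<in>UNIV. A s $ i $ j * x $ j))"
    unfolding sum_distrib_right sum_distrib_left mult.assoc by (rule sum.swap)
  then show "(pencil A0 A lam *v x) $ i = (A0 *v x + (\<Sum>s\<in>UNIV. lam $ s *s (A s *v x))) $ i"
    by (simp add: pencil_def matrix_vector_mult_def distrib_right sum.distrib)
qed

lemma pencil_add:
  "pencil (A0 + D0) (\<lambda>s. A s + D s) lam = pencil A0 A lam + pencil D0 D lam"
  by (simp add: pencil_def vec_eq_iff distrib_left sum.distrib)

text \<open>
  Applied to the perturbations themselves, this bounds the residual they can cancel.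
\<close>

lemma norm_pencil_mult_vec_le:
  "norm (pencil D0 D lam *v x) \<le> error_weight D0 D lam * norm x"
proof -
  have "norm (pencil D0 D lam *v x)
      \<le> norm (D0 *v x) + (\<Sum>s\<in>UNIV. cmod (lam $ s) * norm (D s *v x))"
    unfolding pencil_mult_vec
    by (rule order_trans[OF norm_triangle_ineq add_left_mono])
      (simp add: norm_smult[symmetric] norm_sum)
  also have "\<dots> \<le> spectral_norm D0 * norm x
      + (\<Sum>s\<in>UNIV. cmod (lam $ s) * (spectral_norm (D s) * norm x))"
    by (intro add_mono sum_mono mult_left_mono norm_mult_vec_le) simp
  also have "\<dots> = error_weight D0 D lam * norm x"
    by (simp add: error_weight_def distrib_right sum_distrib_right mult.assoc)
  finally show ?thesis .
qed

definition outer :: "complex^'k \<Rightarrow> complex^'l \<Rightarrow> complex^'l^'k" where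
  "outer r x = (\<chi> i j. r $ i * cnj (x $ j))"

lemma outer_mult_vec: "outer r x *v y = (\<Sum>j\<in>UNIV. cnj (x $ j) * y $ j) *s r"
  by (simp add: outer_def vec_eq_iff matrix_vector_mult_def sum_distrib_left sum_distrib_right mult_ac)

lemma outer_mult_unit: 
  assumes "norm x = 1"
  shows "outer r x *v x = r"
proof -
  have "(\<Sum>j\<in>UNIV. cnj (x $ j) * x $ j) = complex_of_real (\<Sum>j\<in>UNIV. (cmod (x $ j))\<^sup>2)"
    by (simp only: of_real_sum complex_norm_square mult.commute)
  also have "(\<Sum>j\<in>UNIV. (cmod (x $ j))\<^sup>2) = 1"
    using assms by (simp add: norm_vec_def L2_set_def)
  finally show ?thesis by (simp add: outer_mult_vec)
qed

text \<open>
  By Cauchy--Schwarz, a rank-one matrix is no larger than the product of the norms of its factors.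
\<close>

lemma spectral_norm_smult_outer_le:
  assumes "norm x = 1"
  shows "spectral_norm (outer (c *s r) x) \<le> cmod c * norm r"
  unfolding spectral_norm_def
proof (rule onorm_le)
  fix y
  have "cmod (\<Sum>j\<in>UNIV. cnj (x $ j) * y $ j) \<le> (\<Sum>j\<in>UNIV. \<bar>cmod (x $ j)\<bar> * \<bar>cmod (y $ j)\<bar>)"
    by (rule order_trans[OF norm_sum]) (simp add: norm_mult)
  also have "\<dots> \<le> norm x * norm y"
    unfolding norm_vec_def by (rule L2_set_mult_ineq)
  finally have "cmod (\<Sum>j\<in>UNIV. cnj (x $ j) * y $ j) \<le> norm y" using assms by simp
  then show "norm (outer (c *s r) x *v y) \<le> cmod c * norm r * norm y"
    unfolding outer_mult_vec norm_smult by (metis mult.commute mult_left_mono mult_nonneg_nonneg norm_ge_zero)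
qed

text \<open>
  The right-hand side is written without a quotient, so the case of vanishing weight is covered:
  there only a zero residual is admissible.
\<close>

lemma admissible_backward_error_iff:
  assumes x: "norm x = 1"
  shows "admissible_backward_error A0 A E0 E lam x e \<longleftrightarrow>
     0 \<le> e \<and> norm (pencil A0 A lam *v x) \<le> e * error_weight E0 E lam"
proof
  assume "admissible_backward_error A0 A E0 E lam x e"
  then obtain D0 D where e: "0 \<le> e"
    and eq: "pencil A0 A lam *v x + pencil D0 D lam *v x = 0"
    and D: "spectral_norm D0 \<le> e * spectral_norm E0"
      "\<And>s. spectral_norm (D s) \<le> e * spectral_norm (E s)"
    unfolding admissible_backward_error_def pencil_add matrix_vector_mult_add_rdistrib by auto
  have "norm (pencil A0 A lam *v x) = norm (pencil D0 D lam *v x)"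
    using eq by (metis add_eq_0_iff norm_minus_cancel)
  also have "\<dots> \<le> error_weight D0 D lam"
    using norm_pencil_mult_vec_le[of D0 D lam x] x by simp
  also have "\<dots> \<le> e * spectral_norm E0 + (\<Sum>s\<in>UNIV. cmod (lam $ s) * (e * spectral_norm (E s)))"
    unfolding error_weight_def by (intro add_mono sum_mono mult_left_mono D) simp
  also have "\<dots> = e * error_weight E0 E lam"
    by (simp add: error_weight_def distrib_left sum_distrib_left mult_ac)
  finally show "0 \<le> e \<and> norm (pencil A0 A lam *v x) \<le> e * error_weight E0 E lam"
    using e by simp
next
  let ?g = "error_weight E0 E lam"
  define r where "r = pencil A0 A lam *v x"
  assume "0 \<le> e \<and> norm (pencil A0 A lam *v x) \<le> e * ?g"
  then have e: "0 \<le> e" and r: "norm r \<le> e * ?g" by (auto simp: r_def)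
  \<comment> \<open>With zero weight the residual vanishes and division by zero makes \<open>p\<close> zero, so the same
    witnesses remain valid.\<close>
  define p where "p n = complex_of_real (- n / ?g)" for n :: real
  define D0 where "D0 = outer (p (spectral_norm E0) *s r) x"
  define D where "D s = outer ((cnj (sgn (lam $ s)) * p (spectral_norm (E s))) *s r) x" for s
  have p: "cmod (p n) * norm r \<le> e * n" if n: "0 \<le> n" for n
  proof (cases "?g = 0")
    case False
    then have g: "0 < ?g" using error_weight_nonneg[of E0 E lam] by simp
    then have "n * norm r \<le> n * (e * ?g)"
      by (intro mult_left_mono r n)
    then show ?thesis
      using g n unfolding p_def norm_of_real by (simp add: field_simps)
  qed (use r e n in \<open>simp add: p_def\<close>)
  have "spectral_norm D0 \<le> e * spectral_norm E0"
    unfolding D0_def by (rule order_trans[OF spectral_norm_smult_outer_le[OF x] p[OF spectral_norm_nonneg]])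
  moreover have "spectral_norm (D s) \<le> e * spectral_norm (E s)" for s
  proof -
    have "spectral_norm (D s) \<le> cmod (sgn (lam $ s)) * (cmod (p (spectral_norm (E s))) * norm r)"
      unfolding D_def using spectral_norm_smult_outer_le[OF x, of "cnj (sgn (lam $ s)) * p (spectral_norm (E s))" r]
      by (simp add: norm_mult mult.assoc)
    also have "\<dots> \<le> 1 * (cmod (p (spectral_norm (E s))) * norm r)"
      by (intro mult_right_mono) (auto simp: norm_sgn)
    also have "\<dots> \<le> e * spectral_norm (E s)" using p[OF spectral_norm_nonneg] by simp
    finally show ?thesis .
  qed
  moreover have "pencil (A0 + D0) (\<lambda>s. A s + D s) lam *v x = 0"
  proof -
    \<comment> \<open>The conjugate phase turns the factor \<open>lam $ s\<close> of the pencil into its modulus.\<close>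
    have sg: "z * cnj (sgn z) = complex_of_real (cmod z)" for z
      by (simp add: sgn_eq complex_norm_square[symmetric] power2_eq_square field_simps)
    have "pencil D0 D lam *v x
        = (p (spectral_norm E0) + (\<Sum>s\<in>UNIV. complex_of_real (cmod (lam $ s)) * p (spectral_norm (E s)))) *s r"
      unfolding pencil_mult_vec D0_def D_def outer_mult_unit[OF x]
      by (simp add: vec_eq_iff sg mult.assoc[symmetric] distrib_right sum_distrib_right)
    also have "p (spectral_norm E0) + (\<Sum>s\<in>UNIV. complex_of_real (cmod (lam $ s)) * p (spectral_norm (E s)))
        = complex_of_real (- ?g / ?g)"
      unfolding p_def error_weight_def[of E0 E lam]
      by (simp add: add_divide_distrib sum_divide_distrib sum_negf diff_divide_distrib)
    also have "\<dots> *s r = - r"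
      using r by (cases "?g = 0") (auto simp: vec_eq_iff)
    finally show ?thesis by (simp add: pencil_add matrix_vector_mult_add_rdistrib r_def)
  qed
  ultimately show "admissible_backward_error A0 A E0 E lam x e"
    unfolding admissible_backward_error_def using e by blast
qed

lemma backward_error_eq:
  assumes "norm x = 1"
  shows "backward_error A0 A E0 E lam x =
    ereal (norm (pencil A0 A lam *v x)) / ereal (error_weight E0 E lam)"
proof -
  let ?n = "norm (pencil A0 A lam *v x)" and ?g = "error_weight E0 E lam"
  note adm = admissible_backward_error_iff[OF assms, of A0 A E0 E lam]
  have g: "0 \<le> ?g" by (rule error_weight_nonneg)
  show ?thesis
  proof (cases "?g = 0 \<and> ?n \<noteq> 0")
    case True
    then show ?thesis unfolding backward_error_def adm
      by (auto simp: ereal_quotient_convention)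
  next
    case False
    have least: "0 \<le> e \<and> ?n \<le> e * ?g \<longleftrightarrow> ?n / ?g \<le> e" for e
    proof (cases "?g = 0")
      case True
      then show ?thesis using False by simp
    next
      case g0: False
      then have "0 < ?g" using g by simp
      then have "?n \<le> e * ?g \<longleftrightarrow> ?n / ?g \<le> e" and "0 \<le> ?n / ?g"
        by (auto simp: pos_divide_le_eq)
      then show ?thesis by linarith
    qed
    have "(LEAST e. ?n / ?g \<le> e) = ?n / ?g" by (rule Least_equality) auto
    then show ?thesis using False
      unfolding backward_error_def adm least by (auto simp: ereal_quotient_convention)
  qed
qed

theorem mainTheorem2:
  fixes A0 E0 :: "complex^'l^'k"
    and A E :: "'m::finite \<Rightarrow> complex^'l^'k"
    and lam :: "complex^'m"
  assumes "CARD('k) = CARD('l) + CARD('m) - 1"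
    and "full_normal_rank A0 A"
  shows "backward_eigenvalue_error A0 A E0 E lam =
           ereal (sigma_min (pencil A0 A lam)) / ereal (error_weight E0 E lam)"
proof -
  obtain x where x: "norm x = 1" "norm (pencil A0 A lam *v x) = sigma_min (pencil A0 A lam)"
    and min: "\<And>y. norm y = 1 \<Longrightarrow> sigma_min (pencil A0 A lam) \<le> norm (pencil A0 A lam *v y)"
    by (rule sigma_min_attained[of "pencil A0 A lam"]) blast
  have s: "0 \<le> sigma_min (pencil A0 A lam)" using x(2) by (metis norm_ge_zero)
  show ?thesis
    unfolding backward_eigenvalue_error_def
  proof (rule Least_equality)
    show "\<exists>x. norm x = 1 \<and> ereal (sigma_min (pencil A0 A lam)) / ereal (error_weight E0 E lam)
        = backward_error A0 A E0 E lam x"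
      using backward_error_eq[OF x(1)] x by metis
  next
    fix b assume "\<exists>x. norm x = 1 \<and> b = backward_error A0 A E0 E lam x"
    then obtain y where y: "norm y = 1" "b = backward_error A0 A E0 E lam y" by blast
    then show "ereal (sigma_min (pencil A0 A lam)) / ereal (error_weight E0 E lam) \<le> b"
      using s min[OF y(1)] error_weight_nonneg[of E0 E lam]
      unfolding y(2) backward_error_eq[OF y(1)]
      by (auto simp: ereal_quotient_convention divide_right_mono)
  qed
qed

end
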